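(* Let $m$ be a positive integer. (i) Let $a_1, a_2, \ldots, a_m$ be distinct positive rational numbers. Then the $m$ functions $\theta_3(a_1\tau), \theta_3(a_2\tau), \ldots, \theta_3(a_m\tau)$ of $\tau\in\mathbb{H}$ are linearly independent over $\mathbb{C}(\tau)$. (ii) Let $\alpha_1, \alpha_2, \ldots, \alpha_m$ be distinct positive real numbers. Then the $m$ functions $\theta_3(\alpha_1\tau), \theta_3(\alpha_2\tau), \ldots, \theta_3(\alpha_m\tau)$ of $\tau\in\mathbb{H}$ are linearly independent over $\mathbb{C}$.
   Context: $\mathbb{H}$ is the complex upper half plane. For $\tau\in\mathbb{H}$, $\theta_3(\tau)=1+2\sum_{n=1}^\infty q^{n^2}$ with $q=e^{i\pi\tau}$. $\mathbb{C}(\tau)$ is the field of rational functions in the variable $\tau$ with complex coefficients. *)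

theory Defs
  imports
    "HOL-Complex_Analysis.Complex_Analysis"
    "HOL-Computational_Algebra.Computational_Algebra"
    "HOL-Computational_Algebra.Field_as_Ring"
begin

definition upper_half_plane :: "complex set" where
  "upper_half_plane = {\<tau>. Im \<tau> > 0}"

definition theta3 :: "complex \<Rightarrow> complex" where
  "theta3 \<tau> = (let q = exp (\<i> * of_real pi * \<tau>) in 1 + 2 * (\<Sum>n. q ^ ((Suc n)\<^sup>2)))"

lemma summable_theta3:
  assumes "\<tau> \<in> upper_half_plane"
  shows "summable (\<lambda>n. exp (\<i> * of_real pi * \<tau>) ^ ((Suc n)\<^sup>2))"
proof -
  define q where "q = exp (\<i> * of_real pi * \<tau>)"
  have q: "norm q < 1"
    using assms by (auto simp: q_def upper_half_plane_def norm_exp_eq_Re)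
  have "summable (\<lambda>n. norm q ^ n)"
    using q by (simp add: summable_geometric)
  moreover have "norm (q ^ ((Suc n)\<^sup>2)) \<le> norm q ^ n" for n
  proof -
    have "n \<le> (Suc n)\<^sup>2"
      by (simp add: power2_eq_square)
    then show ?thesis
      using q by (simp add: norm_power power_decreasing)
  qed
  ultimately show ?thesis
    unfolding q_def by (rule summable_comparison_test')
qed

text \<open>
  The field of rational functions in one variable over the complex numbers is the fraction
  field of the polynomial ring, \<^typ>\<open>complex poly fract\<close>. The reduced representation
  \<^const>\<open>quot_of_fract\<close> has coprime numerator and denominator, so the zeros of its
  denominator are exactly the poles.
\<close>

definition ratfun_poles :: "complex poly fract \<Rightarrow> complex set" where
  "ratfun_poles r = {z. poly (snd (quot_of_fract r)) z = 0}"

definition ratfun_eval :: "complex poly fract \<Rightarrow> complex \<Rightarrow> complex" where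
  "ratfun_eval r z = poly (fst (quot_of_fract r)) z / poly (snd (quot_of_fract r)) z"

lemma finite_ratfun_poles: "finite (ratfun_poles r)"
  unfolding ratfun_poles_def by (intro poly_roots_finite) simp

lemma ratfun_Fract:
  assumes "poly q z \<noteq> 0"
  shows "z \<notin> ratfun_poles (Fract p q)" "ratfun_eval (Fract p q) z = poly p z / poly q z"
proof -
  obtain a b where ab: "quot_of_fract (Fract p q) = (a, b)"
    by fastforce
  have b: "b \<noteq> 0"
    using snd_quot_of_fract_nonzero[of "Fract p q"] ab by simp
  have q: "q \<noteq> 0"
    using assms by auto
  have cop: "coprime a b"
    using coprime_quot_of_fract[of "Fract p q"] ab by simp
  have "Fract a b = Fract p q"
    using Fract_quot_of_fract[of "Fract p q"] ab by simp
  then have eq: "a * q = p * b"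
    using b q by (simp add: eq_fract)
  then have "b dvd a * q"
    by simp
  then have "b dvd q"
    using cop by (simp add: coprime_commute coprime_dvd_mult_right_iff)
  then have bz: "poly b z \<noteq> 0"
    using assms by (auto elim!: dvdE)
  have "poly a z * poly q z = poly p z * poly b z"
    using eq by (metis poly_mult)
  then show "z \<notin> ratfun_poles (Fract p q)" "ratfun_eval (Fract p q) z = poly p z / poly q z"
    using bz assms ab by (auto simp: ratfun_poles_def ratfun_eval_def field_simps)
qed

text \<open>
  Linear independence of a finite family of functions on the upper half plane: being a statement
  about families rather than sets, it forces the members to be distinct. The coefficients may have
  poles in the upper half plane, so a linear relation is an identity of meromorphic functions, that
  is, an identity at all points that are not a pole of any coefficient.
\<close>

definition lin_indep_over_ratfuns :: "'i set \<Rightarrow> ('i \<Rightarrow> complex \<Rightarrow> complex) \<Rightarrow> bool" where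
  "lin_indep_over_ratfuns I f \<longleftrightarrow>
     (\<forall>r :: 'i \<Rightarrow> complex poly fract.
        (\<forall>\<tau> \<in> upper_half_plane - (\<Union>i\<in>I. ratfun_poles (r i)).
           (\<Sum>i\<in>I. ratfun_eval (r i) \<tau> * f i \<tau>) = 0) \<longrightarrow>
        (\<forall>i\<in>I. r i = 0))"

definition lin_indep_over_complex :: "'i set \<Rightarrow> ('i \<Rightarrow> complex \<Rightarrow> complex) \<Rightarrow> bool" where
  "lin_indep_over_complex I f \<longleftrightarrow>
     (\<forall>c :: 'i \<Rightarrow> complex.
        (\<forall>\<tau> \<in> upper_half_plane. (\<Sum>i\<in>I. c i * f i \<tau>) = 0) \<longrightarrow>
        (\<forall>i\<in>I. c i = 0))"

end

theory Submission
  imports Defs "HOL-Real_Asymp.Real_Asymp"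
begin

text \<open>
  Everything happens on the imaginary axis \<open>\<tau> = \<i>t\<close> as \<open>t \<rightarrow> \<infinity>\<close>. There
  \<open>theta3 (\<alpha>\<tau>) = 1 + 2 exp (-\<pi>\<alpha>t) + O(exp (-2\<pi>\<alpha>t))\<close> for every real \<open>\<alpha> > 0\<close>
  (\<open>norm_theta3_minus_1_minus_2_nome_le\<close>), whereas polynomials in \<open>\<tau>\<close> neither vanish in the
  limit unless they are zero (\<open>poly_imaginary_axis_tendsto_0_imp_eq_0\<close>) nor compensate an
  exponential decay (\<open>tendsto_poly_mult_exp_decay\<close>).

  Suppose \<open>\<Sum> p\<^sub>i theta3 (\<alpha>\<^sub>i\<tau>) = 0\<close> with polynomials \<open>p\<^sub>i\<close>, none of them zero. The constant
  terms of the theta series show that \<open>\<Sum> p\<^sub>i\<close> tends to \<open>0\<close>, so \<open>\<Sum> p\<^sub>i = 0\<close> and only the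
  exponentially small parts remain. Among these, the term \<open>2 exp (-\<pi>\<alpha>\<^sub>kt)\<close> belonging to the
  smallest \<open>\<alpha>\<^sub>k\<close> decays strictly more slowly than all the others, because the \<open>\<alpha>\<^sub>i\<close> are
  distinct; hence \<open>p\<^sub>k\<close> tends to \<open>0\<close>, so it is zero, a contradiction
  (\<open>theta3_polynomial_relation_trivial\<close>).

  Rational coefficients reduce to polynomial ones by clearing denominators. Only the sizes of the
  \<open>\<alpha>\<^sub>i\<close> enter, so independence over the rational functions holds for all distinct positive real
  \<open>\<alpha>\<^sub>i\<close> (\<open>theta3_lin_indep_over_ratfuns\<close>), and both assertions are special cases of this.
\<close>

section \<open>The theta function near the cusp at infinity\<close>

text \<open>
  The exponents after the first are \<open>(n + 2)\<^sup>2 \<ge> n + 2\<close>, so a geometric series dominates the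
  tail; the bound \<open>1/2\<close> serves to make its sum at most \<open>2 \<bar>q\<bar>\<^sup>2\<close>.
\<close>

lemma norm_theta3_minus_1_minus_2_nome_le:
  fixes \<tau> :: complex
  defines "q \<equiv> exp (\<i> * of_real pi * \<tau>)"
  assumes q: "norm q \<le> 1 / 2"
  shows "norm (theta3 \<tau> - 1 - 2 * q) \<le> 4 * norm q ^ 2"
proof -
  have tail: "norm (q ^ ((Suc (Suc n))\<^sup>2)) \<le> norm q ^ 2 * (1 / 2) ^ n" for n
  proof -
    have "n + 2 \<le> (Suc (Suc n))\<^sup>2"
      by (simp add: power2_eq_square)
    then have "norm q ^ ((Suc (Suc n))\<^sup>2) \<le> norm q ^ (n + 2)"
      using q by (intro power_decreasing) auto
    also have "\<dots> = norm q ^ 2 * norm q ^ n"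
      by (simp add: power_add power2_eq_square)
    also have "\<dots> \<le> norm q ^ 2 * (1 / 2) ^ n"
      using q by (intro mult_left_mono power_mono) auto
    finally show ?thesis
      by (simp add: norm_power)
  qed
  have geom: "(\<lambda>n. norm q ^ 2 * (1 / 2) ^ n) sums (norm q ^ 2 * 2)"
    using sums_mult[OF geometric_sums[of "1 / 2 :: real"], of "norm q ^ 2"] by simp
  have summable_tail: "summable (\<lambda>n. q ^ ((Suc (Suc n))\<^sup>2))"
    using tail by (intro summable_comparison_test'[OF sums_summable[OF geom]]) auto
  have "theta3 \<tau> = 1 + 2 * (\<Sum>n. q ^ ((Suc n)\<^sup>2))"
    by (simp add: theta3_def q_def)
  also have "(\<Sum>n. q ^ ((Suc n)\<^sup>2)) = q + (\<Sum>n. q ^ ((Suc (Suc n))\<^sup>2))"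
    using suminf_split_head[of "\<lambda>n. q ^ ((Suc n)\<^sup>2)"]
      summable_tail summable_Suc_iff[of "\<lambda>n. q ^ ((Suc n)\<^sup>2)"] by simp
  finally have "norm (theta3 \<tau> - 1 - 2 * q) = 2 * norm (\<Sum>n. q ^ ((Suc (Suc n))\<^sup>2))"
    by (simp add: algebra_simps norm_mult)
  also have "norm (\<Sum>n. q ^ ((Suc (Suc n))\<^sup>2)) \<le> norm q ^ 2 * 2"
    using norm_suminf_le[OF tail sums_summable[OF geom]] sums_unique[OF geom] by simp
  finally show ?thesis
    by simp
qed

text \<open>
  In a linear relation, the first estimate serves for the dominant term, where the coefficient of
  \<open>exp (-\<pi>\<alpha>t)\<close> matters, and the second for all other terms.
\<close>

lemma eventually_theta3_imaginary_axis:
  fixes \<alpha> :: real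
  assumes "\<alpha> > 0"
  shows "eventually (\<lambda>t. norm (theta3 (of_real \<alpha> * (\<i> * of_real t)) - 1
             - 2 * of_real (exp (- (pi * \<alpha>) * t))) \<le> 4 * exp (- (2 * pi * \<alpha>) * t)) at_top"
    and "eventually (\<lambda>t. norm (theta3 (of_real \<alpha> * (\<i> * of_real t)) - 1)
             \<le> 4 * exp (- (pi * \<alpha>) * t)) at_top"
proof -
  define e where "e t = exp (- (pi * \<alpha>) * t)" for t
  have e_pos: "e t > 0" for t
    by (simp add: e_def)
  have e2: "exp (- (2 * pi * \<alpha>) * t) = e t ^ 2" for t
    by (simp add: e_def power2_eq_square flip: exp_add)
  have nome: "exp (\<i> * of_real pi * (of_real \<alpha> * (\<i> * of_real t))) = complex_of_real (e t)" for t
  proof -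
    have "\<i> * of_real pi * (of_real \<alpha> * (\<i> * of_real t)) = complex_of_real (- (pi * \<alpha>) * t)"
      by (simp add: mult_ac)
    then show ?thesis
      by (simp only: e_def exp_of_real)
  qed
  have "(e \<longlongrightarrow> 0) at_top"
    unfolding e_def using assms pi_gt_zero by real_asymp
  then have small: "eventually (\<lambda>t. e t \<le> 1 / 2) at_top"
    by (auto dest!: order_tendstoD(2)[where a = "1 / 2"] elim!: eventually_mono)
  have first: "norm (theta3 (of_real \<alpha> * (\<i> * of_real t)) - 1 - 2 * of_real (e t)) \<le> 4 * e t ^ 2"
    if "e t \<le> 1 / 2" for t
    using norm_theta3_minus_1_minus_2_nome_le[of "of_real \<alpha> * (\<i> * of_real t)"] that e_pos[of t]
    unfolding nome by simp
  show "eventually (\<lambda>t. norm (theta3 (of_real \<alpha> * (\<i> * of_real t)) - 1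
             - 2 * of_real (exp (- (pi * \<alpha>) * t))) \<le> 4 * exp (- (2 * pi * \<alpha>) * t)) at_top"
    using small unfolding e2 by (rule eventually_mono) (use first in \<open>simp add: e_def\<close>)
  have "norm (theta3 (of_real \<alpha> * (\<i> * of_real t)) - 1) \<le> 4 * e t" if "e t \<le> 1 / 2" for t
  proof -
    have "norm (theta3 (of_real \<alpha> * (\<i> * of_real t)) - 1) \<le> 4 * e t ^ 2 + norm (2 * complex_of_real (e t))"
      using first[OF that] by norm
    also have "\<dots> = 4 * e t * e t + 2 * e t"
      using e_pos[of t] by (simp add: norm_mult power2_eq_square)
    also have "4 * e t * e t \<le> 4 * e t * (1 / 2)"
      using that e_pos[of t] by (intro mult_left_mono) auto
    finally show ?thesis
      by simp
  qed
  then show "eventually (\<lambda>t. norm (theta3 (of_real \<alpha> * (\<i> * of_real t)) - 1)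
             \<le> 4 * exp (- (pi * \<alpha>) * t)) at_top"
    using small by (auto simp: e_def elim!: eventually_mono)
qed

section \<open>Polynomials on the imaginary axis\<close>

lemma filterlim_imaginary_axis_at_infinity:
  "filterlim (\<lambda>t. \<i> * complex_of_real t) at_infinity at_top"
proof -
  have "filterlim (\<lambda>t. norm (\<i> * complex_of_real t)) at_top at_top"
    by (simp add: norm_mult filterlim_abs_real)
  then show ?thesis
    by (simp add: filterlim_norm_at_top_imp_at_infinity)
qed

lemma eventually_poly_nonzero_at_infinity:
  fixes p :: "'a :: real_normed_field poly"
  assumes "p \<noteq> 0"
  shows "eventually (\<lambda>z. poly p z \<noteq> 0) at_infinity"
proof -
  obtain C where C: "\<And>z. poly p z = 0 \<Longrightarrow> norm z \<le> C"
    using finite_imp_bounded[OF poly_roots_finite[OF assms]] by (auto simp: bounded_iff)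
  have "poly p z \<noteq> 0" if "norm z \<ge> C + 1" for z
    using C[of z] that by auto
  then show ?thesis
    by (auto simp: eventually_at_infinity)
qed

lemma poly_imaginary_axis_tendsto_0_imp_eq_0:
  fixes p :: "complex poly"
  assumes lim: "((\<lambda>t. poly p (\<i> * of_real t)) \<longlongrightarrow> 0) at_top"
  shows "p = 0"
proof (cases "degree p = 0")
  case True
  then obtain c where "p = [:c:]"
    by (auto elim: degree_eq_zeroE)
  then show ?thesis
    using lim by (simp add: tendsto_const_iff)
next
  case False
  then have "filterlim (\<lambda>t. poly p (\<i> * of_real t)) at_infinity at_top"
    by (intro filterlim_compose[OF filterlim_poly_at_infinity filterlim_imaginary_axis_at_infinity])
      auto
  then show ?thesis
    using lim not_tendsto_and_filterlim_at_infinity[OF trivial_limit_at_top_linorder] by blast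
qed

lemma tendsto_poly_mult_exp:
  fixes p :: "complex poly"
  assumes "c > 0"
  shows "((\<lambda>t. poly p (\<i> * of_real t) * of_real (exp (- c * t))) \<longlongrightarrow> 0) at_top"
  using assms
proof (induction p arbitrary: c)
  case 0
  then show ?case
    by simp
next
  case (pCons a p)
  have "((\<lambda>t. exp (- c * t)) \<longlongrightarrow> 0) at_top"
    using pCons.prems by real_asymp
  then have const: "((\<lambda>t. a * of_real (exp (- c * t))) \<longlongrightarrow> 0) at_top"
    by (intro tendsto_mult_right_zero) (metis of_real_0 tendsto_of_real)
  \<comment> \<open>Half of the decay pays for the additional factor \<open>t\<close>, the other half for \<open>p\<close>.\<close>
  define h where "h t = complex_of_real (exp (- (c / 2) * t))" for t
  have h: "of_real (exp (- c * t)) = h t * h t" for t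
    unfolding h_def by (simp flip: of_real_mult exp_add)
  have IH: "((\<lambda>t. poly p (\<i> * of_real t) * h t) \<longlongrightarrow> 0) at_top"
    unfolding h_def by (intro pCons.IH) (use pCons.prems in simp)
  have "((\<lambda>t. t * exp (- (c / 2) * t)) \<longlongrightarrow> 0) at_top"
    using pCons.prems by real_asymp
  then have linear: "((\<lambda>t. of_real t * h t) \<longlongrightarrow> 0) at_top"
    unfolding h_def of_real_mult[symmetric] by (metis of_real_0 tendsto_of_real)
  have "((\<lambda>t. a * (h t * h t) + \<i> * (of_real t * h t) * (poly p (\<i> * of_real t) * h t))
      \<longlongrightarrow> 0 + \<i> * 0 * 0) at_top"
    using const unfolding h by (intro tendsto_add tendsto_mult tendsto_const linear IH)
  then show ?case
    unfolding h by (simp add: algebra_simps)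
qed

lemma tendsto_poly_mult_exp_decay:
  fixes p :: "complex poly" and g :: "real \<Rightarrow> complex"
  assumes "c > 0" and bound: "eventually (\<lambda>t. norm (g t) \<le> C * exp (- c * t)) at_top"
  shows "((\<lambda>t. poly p (\<i> * of_real t) * g t) \<longlongrightarrow> 0) at_top"
proof (rule Lim_null_comparison)
  show "eventually (\<lambda>t. norm (poly p (\<i> * of_real t) * g t)
      \<le> C * norm (poly p (\<i> * of_real t) * of_real (exp (- c * t)))) at_top"
    using bound
  proof eventually_elim
    case (elim t)
    have "norm (poly p (\<i> * of_real t)) * norm (g t)
        \<le> norm (poly p (\<i> * of_real t)) * (C * exp (- c * t))"
      using elim by (intro mult_left_mono) auto
    then show ?case
      by (simp add: norm_mult mult_ac)
  qed
  show "((\<lambda>t. C * norm (poly p (\<i> * of_real t) * of_real (exp (- c * t)))) \<longlongrightarrow> 0) at_top"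
    by (intro tendsto_mult_right_zero tendsto_norm_zero tendsto_poly_mult_exp assms)
qed

section \<open>Polynomial relations\<close>

text \<open>
  It is enough that the relation holds far up on the imaginary axis: this leaves room for the
  finitely many poles of rational coefficients.
\<close>

lemma theta3_polynomial_relation_trivial:
  fixes \<alpha> :: "'i \<Rightarrow> real" and p :: "'i \<Rightarrow> complex poly"
  assumes fin: "finite I" and inj: "inj_on \<alpha> I" and pos: "\<And>i. i \<in> I \<Longrightarrow> \<alpha> i > 0"
    and rel: "eventually (\<lambda>t. (\<Sum>i\<in>I. poly (p i) (\<i> * of_real t) *
                 theta3 (of_real (\<alpha> i) * (\<i> * of_real t))) = 0) at_top"
  shows "\<forall>i\<in>I. p i = 0"
proof (rule ccontr)
  define \<theta> where "\<theta> i t = theta3 (of_real (\<alpha> i) * (\<i> * of_real t))" for i t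
  define P where "P i t = poly (p i) (\<i> * complex_of_real t)" for i t
  define J where "J = {i \<in> I. p i \<noteq> 0}"
  assume "\<not> ?thesis"
  then have "J \<noteq> {}" and finJ: "finite J"
    using fin by (auto simp: J_def)
  have posJ: "pi * \<alpha> i > 0" if "i \<in> J" for i
    using that pos by (simp add: J_def)
  define k where "k = arg_min_on \<alpha> J"
  have k: "k \<in> J" and k_min: "\<And>i. i \<in> J \<Longrightarrow> \<alpha> k \<le> \<alpha> i"
    using arg_min_if_finite[OF finJ \<open>J \<noteq> {}\<close>, of \<alpha>] by (auto simp: k_def not_less)
  have k_less: "\<alpha> k < \<alpha> i" if "i \<in> J - {k}" for i
    using that k k_min[of i] inj by (fastforce simp: J_def inj_on_def less_le)
  have \<theta>1: "eventually (\<lambda>t. norm (\<theta> i t - 1) \<le> 4 * exp (- (pi * \<alpha> i) * t)) at_top"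
    if "i \<in> J" for i
    unfolding \<theta>_def using that pos by (intro eventually_theta3_imaginary_axis) (simp add: J_def)
  have \<theta>2: "eventually (\<lambda>t. norm (\<theta> k t - 1 - 2 * of_real (exp (- (pi * \<alpha> k) * t)))
      \<le> 4 * exp (- (2 * pi * \<alpha> k) * t)) at_top"
    unfolding \<theta>_def using k pos by (intro eventually_theta3_imaginary_axis) (simp add: J_def)
  have relJ: "eventually (\<lambda>t. (\<Sum>i\<in>J. P i t * \<theta> i t) = 0) at_top"
    using rel
  proof eventually_elim
    case (elim t)
    have "(\<Sum>i\<in>J. P i t * \<theta> i t) = (\<Sum>i\<in>I. P i t * \<theta> i t)"
      by (rule sum.mono_neutral_left) (use fin in \<open>auto simp: J_def P_def\<close>)
    then show ?case
      using elim by (simp add: P_def \<theta>_def)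
  qed

  have "((\<lambda>t. \<Sum>i\<in>J. P i t * (\<theta> i t - 1)) \<longlongrightarrow> (\<Sum>i\<in>J. 0)) at_top"
    unfolding P_def by (intro tendsto_sum tendsto_poly_mult_exp_decay[OF _ \<theta>1] posJ)
  then have "((\<lambda>t. - (\<Sum>i\<in>J. P i t * (\<theta> i t - 1))) \<longlongrightarrow> 0) at_top"
    using tendsto_minus by fastforce
  then have "((\<lambda>t. poly (\<Sum>i\<in>J. p i) (\<i> * of_real t)) \<longlongrightarrow> 0) at_top"
  proof (rule Lim_transform_eventually)
    show "eventually (\<lambda>t. - (\<Sum>i\<in>J. P i t * (\<theta> i t - 1)) = poly (\<Sum>i\<in>J. p i) (\<i> * of_real t)) at_top"
      using relJ
    proof eventually_elim
      case (elim t)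
      then show ?case
        by (simp add: right_diff_distrib sum_subtractf poly_sum P_def)
    qed
  qed
  then have sum0: "(\<Sum>i\<in>J. p i) = 0"
    by (rule poly_imaginary_axis_tendsto_0_imp_eq_0)
  then have sumP: "(\<Sum>i\<in>J. P i t) = 0" for t
    by (simp add: P_def flip: poly_sum)

  \<comment> \<open>Rescaled so that the leading term of \<open>\<theta> k t - 1\<close> becomes the constant \<open>2\<close>.\<close>
  define S where "S t = complex_of_real (exp (pi * \<alpha> k * t))" for t
  have norm_S: "norm (S t) = exp (pi * \<alpha> k * t)" for t
    by (simp add: S_def)
  have others: "((\<lambda>t. P i t * ((\<theta> i t - 1) * S t)) \<longlongrightarrow> 0) at_top" if i: "i \<in> J - {k}" for i
    unfolding P_def
  proof (rule tendsto_poly_mult_exp_decay)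
    show "pi * (\<alpha> i - \<alpha> k) > 0"
      using k_less[OF i] by simp
    show "eventually (\<lambda>t. norm ((\<theta> i t - 1) * S t) \<le> 4 * exp (- (pi * (\<alpha> i - \<alpha> k)) * t)) at_top"
      using \<theta>1[OF DiffD1[OF i]]
    proof eventually_elim
      case (elim t)
      have "norm ((\<theta> i t - 1) * S t) \<le> 4 * exp (- (pi * \<alpha> i) * t) * exp (pi * \<alpha> k * t)"
        unfolding norm_mult norm_S using elim by (intro mult_right_mono) auto
      also have "\<dots> = 4 * exp (- (pi * (\<alpha> i - \<alpha> k)) * t)"
        by (simp add: algebra_simps flip: exp_add)
      finally show ?case .
    qed
  qed
  have main: "((\<lambda>t. P k t * ((\<theta> k t - 1) * S t - 2)) \<longlongrightarrow> 0) at_top"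
    unfolding P_def
  proof (rule tendsto_poly_mult_exp_decay[OF posJ[OF k]])
    show "eventually (\<lambda>t. norm ((\<theta> k t - 1) * S t - 2) \<le> 4 * exp (- (pi * \<alpha> k) * t)) at_top"
      using \<theta>2
    proof eventually_elim
      case (elim t)
      have "complex_of_real (exp (- (pi * \<alpha> k) * t)) * S t = 1"
        unfolding S_def by (simp flip: of_real_mult exp_add)
      then have "(\<theta> k t - 1) * S t - 2 = (\<theta> k t - 1 - 2 * of_real (exp (- (pi * \<alpha> k) * t))) * S t"
        by (simp add: left_diff_distrib)
      also have "norm \<dots> \<le> 4 * exp (- (2 * pi * \<alpha> k) * t) * exp (pi * \<alpha> k * t)"
        unfolding norm_mult norm_S using elim by (intro mult_right_mono) auto
      also have "\<dots> = 4 * exp (- (pi * \<alpha> k) * t)"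
        by (simp add: algebra_simps flip: exp_add)
      finally show ?case .
    qed
  qed
  have "((\<lambda>t. P k t * ((\<theta> k t - 1) * S t - 2) + (\<Sum>i\<in>J - {k}. P i t * ((\<theta> i t - 1) * S t)))
      \<longlongrightarrow> 0 + (\<Sum>i\<in>J - {k}. 0)) at_top"
    by (intro tendsto_add main tendsto_sum others)
  then have "((\<lambda>t. (P k t * ((\<theta> k t - 1) * S t - 2) + (\<Sum>i\<in>J - {k}. P i t * ((\<theta> i t - 1) * S t)))
      * (- 1 / 2)) \<longlongrightarrow> 0) at_top"
    by (intro tendsto_mult_left_zero) simp
  then have "((\<lambda>t. poly (p k) (\<i> * of_real t)) \<longlongrightarrow> 0) at_top"
  proof (rule Lim_transform_eventually)
    show "eventually (\<lambda>t. (P k t * ((\<theta> k t - 1) * S t - 2) +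
        (\<Sum>i\<in>J - {k}. P i t * ((\<theta> i t - 1) * S t))) * (- 1 / 2) = poly (p k) (\<i> * of_real t)) at_top"
      using relJ
    proof eventually_elim
      case (elim t)
      have "P k t * ((\<theta> k t - 1) * S t) + (\<Sum>i\<in>J - {k}. P i t * ((\<theta> i t - 1) * S t))
          = (\<Sum>i\<in>J. P i t * ((\<theta> i t - 1) * S t))"
        using k finJ by (simp add: sum.remove)
      also have "\<dots> = ((\<Sum>i\<in>J. P i t * \<theta> i t) - (\<Sum>i\<in>J. P i t)) * S t"
        by (simp add: sum_distrib_right left_diff_distrib right_diff_distrib sum_subtractf mult.assoc)
      also have "\<dots> = 0"
        using elim sumP by simp
      finally have cancel: "P k t * ((\<theta> k t - 1) * S t) +
          (\<Sum>i\<in>J - {k}. P i t * ((\<theta> i t - 1) * S t)) = 0" .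
      have "(P k t * ((\<theta> k t - 1) * S t - 2) + (\<Sum>i\<in>J - {k}. P i t * ((\<theta> i t - 1) * S t))) * (- 1 / 2)
          = (P k t * ((\<theta> k t - 1) * S t) + (\<Sum>i\<in>J - {k}. P i t * ((\<theta> i t - 1) * S t))) * (- 1 / 2) + P k t"
        by (simp add: right_diff_distrib diff_divide_distrib add_divide_distrib)
      then show ?case
        unfolding cancel by (simp add: P_def)
    qed
  qed
  then have "p k = 0"
    by (rule poly_imaginary_axis_tendsto_0_imp_eq_0)
  then show False
    using k by (simp add: J_def)
qed

section \<open>Rational and constant coefficients\<close>

lemma theta3_lin_indep_over_ratfuns:
  fixes \<alpha> :: "'i \<Rightarrow> real"
  assumes fin: "finite I" and inj: "inj_on \<alpha> I" and pos: "\<And>i. i \<in> I \<Longrightarrow> \<alpha> i > 0"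
  shows "lin_indep_over_ratfuns I (\<lambda>i \<tau>. theta3 (of_real (\<alpha> i) * \<tau>))"
  unfolding lin_indep_over_ratfuns_def
proof (intro allI impI)
  fix r :: "'i \<Rightarrow> complex poly fract"
  assume rel: "\<forall>\<tau> \<in> upper_half_plane - (\<Union>i\<in>I. ratfun_poles (r i)).
      (\<Sum>i\<in>I. ratfun_eval (r i) \<tau> * theta3 (of_real (\<alpha> i) * \<tau>)) = 0"
  define a b where "a i = fst (quot_of_fract (r i))" and "b i = snd (quot_of_fract (r i))" for i
  define B where "B = (\<Prod>i\<in>I. b i)"
  \<comment> \<open>That is, \<open>r i\<close> multiplied by the common denominator \<open>B\<close>.\<close>
  define p where "p i = a i * (\<Prod>j\<in>I - {i}. b j)" for i
  have b: "b i \<noteq> 0" for i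
    by (simp add: b_def)
  then have "B \<noteq> 0"
    using fin by (simp add: B_def)
  have "\<forall>i\<in>I. p i = 0"
  proof (rule theta3_polynomial_relation_trivial[OF fin inj pos])
    have "eventually (\<lambda>t. poly B (\<i> * complex_of_real t) \<noteq> 0) at_top"
      using eventually_poly_nonzero_at_infinity[OF \<open>B \<noteq> 0\<close>] filterlim_imaginary_axis_at_infinity
      by (rule eventually_compose_filterlim)
    then show "eventually (\<lambda>t. (\<Sum>i\<in>I. poly (p i) (\<i> * of_real t) *
        theta3 (of_real (\<alpha> i) * (\<i> * of_real t))) = 0) at_top"
      using eventually_gt_at_top[of 0]
    proof eventually_elim
      case (elim t)
      define z where "z = \<i> * complex_of_real t"
      have bz: "poly (b i) z \<noteq> 0" if "i \<in> I" for i
        using elim that fin by (simp add: B_def poly_prod z_def)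
      have "poly (p i) z = poly B z * ratfun_eval (r i) z" if "i \<in> I" for i
      proof -
        have "poly B z = poly (b i) z * poly (\<Prod>j\<in>I - {i}. b j) z"
          using that fin by (simp add: B_def prod.remove)
        then show ?thesis
          using bz[OF that] by (simp add: p_def ratfun_eval_def a_def b_def)
      qed
      then have "(\<Sum>i\<in>I. poly (p i) z * theta3 (of_real (\<alpha> i) * z)) =
          poly B z * (\<Sum>i\<in>I. ratfun_eval (r i) z * theta3 (of_real (\<alpha> i) * z))"
        by (simp add: sum_distrib_left mult.assoc)
      moreover have "z \<in> upper_half_plane - (\<Union>i\<in>I. ratfun_poles (r i))"
        using elim bz by (auto simp: upper_half_plane_def ratfun_poles_def z_def b_def)
      ultimately show ?case
        using rel by (simp add: z_def)
    qed
  qed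
  then show "\<forall>i\<in>I. r i = 0"
    using b fin by (auto simp: p_def a_def)
qed

lemma lin_indep_over_ratfuns_imp_over_complex:
  assumes "lin_indep_over_ratfuns I f"
  shows "lin_indep_over_complex I f"
  unfolding lin_indep_over_complex_def
proof (intro allI impI)
  fix c :: "'a \<Rightarrow> complex"
  assume rel: "\<forall>\<tau>\<in>upper_half_plane. (\<Sum>i\<in>I. c i * f i \<tau>) = 0"
  have "ratfun_eval (Fract [:c i:] 1) z = c i" for i z
    using ratfun_Fract(2)[of 1 z "[:c i:]"] by simp
  then have "\<forall>i\<in>I. Fract [:c i:] 1 = 0"
    using assms[unfolded lin_indep_over_ratfuns_def, rule_format, of "\<lambda>i. Fract [:c i:] 1"] rel
    by simp
  then show "\<forall>i\<in>I. c i = 0"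
    by (simp add: Zero_fract_def eq_fract)
qed

lemma of_real_of_rat: "of_real (of_rat x) = (of_rat x :: 'a :: {field_char_0, real_div_algebra})"
  by (cases x) (simp add: of_rat_rat of_real_divide)

theorem theorem1:
  fixes m :: nat
  assumes "m > 0"
  shows
    "(\<forall>a :: nat \<Rightarrow> rat. inj_on a {1..m} \<and> (\<forall>i\<in>{1..m}. a i > 0) \<longrightarrow>
        lin_indep_over_ratfuns {1..m} (\<lambda>i \<tau>. theta3 (of_rat (a i) * \<tau>))) \<and>
     (\<forall>\<alpha> :: nat \<Rightarrow> real. inj_on \<alpha> {1..m} \<and> (\<forall>i\<in>{1..m}. \<alpha> i > 0) \<longrightarrow>
        lin_indep_over_complex {1..m} (\<lambda>i \<tau>. theta3 (of_real (\<alpha> i) * \<tau>)))"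
proof (rule conjI)
  show "\<forall>a :: nat \<Rightarrow> rat. inj_on a {1..m} \<and> (\<forall>i\<in>{1..m}. a i > 0) \<longrightarrow>
      lin_indep_over_ratfuns {1..m} (\<lambda>i \<tau>. theta3 (of_rat (a i) * \<tau>))"
  proof (rule allI, rule impI)
    fix a :: "nat \<Rightarrow> rat"
    assume a: "inj_on a {1..m} \<and> (\<forall>i\<in>{1..m}. a i > 0)"
    have inj: "inj_on (\<lambda>i. real_of_rat (a i)) {1..m}"
      using a unfolding inj_on_def of_rat_eq_iff by blast
    have pos: "real_of_rat (a i) > 0" if "i \<in> {1..m}" for i
      using a that unfolding zero_less_of_rat_iff by blast
    have "lin_indep_over_ratfuns {1..m} (\<lambda>i \<tau>. theta3 (of_real (real_of_rat (a i)) * \<tau>))"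
      by (rule theta3_lin_indep_over_ratfuns[OF finite_atLeastAtMost inj pos])
    then show "lin_indep_over_ratfuns {1..m} (\<lambda>i \<tau>. theta3 (of_rat (a i) * \<tau>))"
      unfolding of_real_of_rat .
  qed
next
  show "\<forall>\<alpha> :: nat \<Rightarrow> real. inj_on \<alpha> {1..m} \<and> (\<forall>i\<in>{1..m}. \<alpha> i > 0) \<longrightarrow>
      lin_indep_over_complex {1..m} (\<lambda>i \<tau>. theta3 (of_real (\<alpha> i) * \<tau>))"
  proof (rule allI, rule impI)
    fix \<alpha> :: "nat \<Rightarrow> real"
    assume \<alpha>: "inj_on \<alpha> {1..m} \<and> (\<forall>i\<in>{1..m}. \<alpha> i > 0)"
    show "lin_indep_over_complex {1..m} (\<lambda>i \<tau>. theta3 (of_real (\<alpha> i) * \<tau>))"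
    proof (rule lin_indep_over_ratfuns_imp_over_complex, rule theta3_lin_indep_over_ratfuns)
      show "inj_on \<alpha> {1..m}"
        using \<alpha> by blast
      show "\<alpha> i > 0" if "i \<in> {1..m}" for i
        using \<alpha> that by blast
    qed simp
  qed
qed

end
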